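(* Let $\mathrm{AG}$ be finite and nonempty, and let $X\in\{\epsilon,\mathtt S,\mathtt I,\mathtt D,\mathtt{SI},\mathtt{SD},\mathtt{ID},\mathtt{SID}\}$. Let $G=(\mathrm{ST},\mathrm{AC},\{\mathrm{av}_C\}_{C\subseteq \mathrm{AG}},\{\mathrm{out}_C\}_{C\subseteq \mathrm{AG}})$ be a general concurrent game $X$-frame. Let $\mathcal N=(\mathrm{ST},\{N_C\}_{C\subseteq\mathrm{AG}})$ be the actual neighborhood frame induced by $G$, that is, $N_C(s)=\{\mathrm{out}_C(s,\sigma_C)\mid \sigma_C\in \mathrm{av}_C(s)\}$ for every $s\in\mathrm{ST}$ and every $C\subseteq\mathrm{AG}$. Then $\mathcal N$ is an AC-abstract-representative actual neighborhood $X$-frame.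
   Context: Let $\mathrm{AG}$ be a finite nonempty set of agents; coalitions are subsets of $\mathrm{AG}$. **Game frames.** Given a nonempty action set $\mathrm{AC}$, $\mathrm{JA}_C$ is the set of functions $C\to\mathrm{AC}$ (so $\mathrm{JA}_\emptyset=\{\emptyset\}$); $\sigma|_C$ denotes restriction. An action frame is $(\mathrm{ST},\mathrm{AC},\{\mathrm{av}_C\}_{C\subseteq\mathrm{AG}},\{\mathrm{out}_C\}_{C\subseteq\mathrm{AG}})$ with $\mathrm{ST}$ and $\mathrm{AC}$ nonempty sets, $\mathrm{av}_C:\mathrm{ST}\to\mathcal P(\mathrm{JA}_C)$ and $\mathrm{out}_C:\mathrm{ST}\times\mathrm{JA}_C\to\mathcal P(\mathrm{ST})$. It is a general concurrent game frame if for all $C\subseteq\mathrm{AG}$, $s\in\mathrm{ST}$: (GCI) for all $\sigma_C\in\mathrm{JA}_C$, $\mathrm{out}_C(s,\sigma_C)=\bigcup\{\mathrm{out}_{\mathrm{AG}}(s,\sigma)\mid\sigma\in\mathrm{JA}_{\mathrm{AG}},\ \sigma|_C=\sigma_C\}$; (ODA) $\mathrm{av}_C(s)=\{\sigma_C\in\mathrm{JA}_C\mid\mathrm{out}_C(s,\sigma_C)\neq\emptyset\}$. It is serial ($\mathtt S$) if $\mathrm{av}_C(s)\ne\emptyset$ for all $C,s$; independent ($\mathtt I$) if for all $s$ and all disjoint $C,D\subseteq\mathrm{AG}$, $\sigma_C\in\mathrm{av}_C(s)$ and $\sigma_D\in\mathrm{av}_D(s)$ imply $\sigma_C\cup\sigma_D\in\mathrm{av}_{C\cup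 D}(s)$; deterministic ($\mathtt D$) if $\mathrm{out}_{\mathrm{AG}}(s,\sigma)$ is a singleton for all $s$ and $\sigma\in\mathrm{av}_{\mathrm{AG}}(s)$. For a string $X$ of the symbols $\mathtt S,\mathtt I,\mathtt D$ ($\epsilon$ is the empty string), an $X$-frame is a general concurrent game frame having every property whose symbol occurs in $X$ (the omitted properties are not required to fail). **Actual neighborhood frames.** An actual neighborhood frame is $\mathcal N=(\mathrm{ST},\{N_C\}_{C\subseteq\mathrm{AG}})$ with $\mathrm{ST}$ a nonempty set and $N_C:\mathrm{ST}\to\mathcal P(\mathcal P(\mathrm{ST}))$. **Abstract actual presentations.** An abstract actual presentation of $\mathcal N$ at $s$ is a tuple $\mathbb I_s=(I_s,o_s,\{\equiv^s_a\}_{a\in\mathrm{AG}})$ where $I_s$ is a (possibly empty) set, $o_s:I_s\to\mathcal P(\mathrm{ST})$, and each $\equiv^s_a$ is an equivalence relation on $I_s$. For $C\subseteq\mathrm{AG}$, $i\equiv^s_C j$ iff $i\equiv^s_a j$ for all $a\in C$ (universal relation if $C=\emptyset$), and $\rho^s_C(i)=\bigcup\{o_s(j)\mid j\in I_s,\ i\equiv^s_C j\}$. It must satisfy: (grand compatibility) $i\equiv^s_{\mathrm{AG}}j$ implies $o_s(i)=o_s(j)$; (coverage) $N_C(s)=\{\rho^s_C(i)\mid i\in I_s\}$ for every $C\subseteq\mathrm{AG}$. An abstract actual presentation of $\mathcal N$ is a family $\mathbb I=(\mathbb I_s)_{s\in\mathrm{ST}}$ of such presentations, one at each $s$. It is amalgamating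 if for every $s$, all $i,j\in I_s$ and all disjoint $C,D\subseteq\mathrm{AG}$ there is $k\in I_s$ with $i\equiv^s_C k$ and $j\equiv^s_D k$. **AC-abstract-representativeness.** $\mathcal N$ is AC-abstract-representative if it has an abstract actual presentation and satisfies liveness: $\emptyset\notin N_C(s)$ for all $s,C$. Such an $\mathcal N$ is AC-abstract-serial if $N_C(s)\neq\emptyset$ for all $s,C$; AC-abstract-independent if it has an amalgamating abstract actual presentation; AC-abstract-deterministic if for every $s$ every element of $N_{\mathrm{AG}}(s)$ is a singleton. An AC-abstract-representative actual neighborhood $X$-frame is an AC-abstract-representative frame that is AC-abstract-serial if $\mathtt S$ occurs in $X$, AC-abstract-independent if $\mathtt I$ occurs in $X$, and AC-abstract-deterministic if $\mathtt D$ occurs in $X$. *)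

theory Defs
  imports Main
begin

section \<open>General concurrent game frames\<close>

text \<open>
  A joint action of a coalition \<open>C\<close> is a partial map with domain exactly \<open>C\<close>; restriction is
  \<open>|`\<close>, and the union of joint actions of disjoint coalitions is \<open>++\<close>.  Components of the
  records below are total functions; their values outside the coalitions contained in \<open>AG\<close>,
  the states and the joint actions of the structure are irrelevant.
\<close>

definition joint_actions :: "'act set \<Rightarrow> 'ag set \<Rightarrow> ('ag \<rightharpoonup> 'act) set" where
  "joint_actions AC C = {\<sigma>. dom \<sigma> = C \<and> ran \<sigma> \<subseteq> AC}"

record ('st, 'act, 'ag) action_frame =
  states :: "'st set"
  actions :: "'act set"
  avail :: "'ag set \<Rightarrow> 'st \<Rightarrow> ('ag \<rightharpoonup> 'act) set"
  outcome :: "'ag set \<Rightarrow> 'st \<Rightarrow> ('ag \<rightharpoonup> 'act) \<Rightarrow> 'st set"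

definition is_action_frame :: "'ag set \<Rightarrow> ('st, 'act, 'ag) action_frame \<Rightarrow> bool" where
  "is_action_frame AG G \<longleftrightarrow>
     states G \<noteq> {} \<and> actions G \<noteq> {} \<and>
     (\<forall>C s. C \<subseteq> AG \<longrightarrow> s \<in> states G \<longrightarrow>
        avail G C s \<subseteq> joint_actions (actions G) C \<and>
        (\<forall>\<sigma> \<in> joint_actions (actions G) C. outcome G C s \<sigma> \<subseteq> states G))"

definition general_concurrent_game_frame ::
    "'ag set \<Rightarrow> ('st, 'act, 'ag) action_frame \<Rightarrow> bool" where
  "general_concurrent_game_frame AG G \<longleftrightarrow>
     is_action_frame AG G \<and>
     (\<forall>C s. C \<subseteq> AG \<longrightarrow> s \<in> states G \<longrightarrow>
        (\<forall>\<sigma>C \<in> joint_actions (actions G) C.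
           outcome G C s \<sigma>C =
             \<Union> {outcome G AG s \<sigma> | \<sigma>. \<sigma> \<in> joint_actions (actions G) AG \<and> \<sigma> |` C = \<sigma>C}) \<and>
        avail G C s = {\<sigma>C \<in> joint_actions (actions G) C. outcome G C s \<sigma>C \<noteq> {}})"

definition game_serial :: "'ag set \<Rightarrow> ('st, 'act, 'ag) action_frame \<Rightarrow> bool" where
  "game_serial AG G \<longleftrightarrow> (\<forall>C s. C \<subseteq> AG \<longrightarrow> s \<in> states G \<longrightarrow> avail G C s \<noteq> {})"

definition game_independent :: "'ag set \<Rightarrow> ('st, 'act, 'ag) action_frame \<Rightarrow> bool" where
  "game_independent AG G \<longleftrightarrow>
     (\<forall>s \<in> states G. \<forall>C D. C \<subseteq> AG \<longrightarrow> D \<subseteq> AG \<longrightarrow> C \<inter> D = {} \<longrightarrow>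
        (\<forall>\<sigma>C \<in> avail G C s. \<forall>\<sigma>D \<in> avail G D s. \<sigma>C ++ \<sigma>D \<in> avail G (C \<union> D) s))"

definition game_deterministic :: "'ag set \<Rightarrow> ('st, 'act, 'ag) action_frame \<Rightarrow> bool" where
  "game_deterministic AG G \<longleftrightarrow>
     (\<forall>s \<in> states G. \<forall>\<sigma> \<in> avail G AG s. is_singleton (outcome G AG s \<sigma>))"

datatype frame_symbol = SymS | SymI | SymD

definition game_X_frame ::
    "frame_symbol list \<Rightarrow> 'ag set \<Rightarrow> ('st, 'act, 'ag) action_frame \<Rightarrow> bool" where
  "game_X_frame X AG G \<longleftrightarrow>
     general_concurrent_game_frame AG G \<and>
     (SymS \<in> set X \<longrightarrow> game_serial AG G) \<and>
     (SymI \<in> set X \<longrightarrow> game_independent AG G) \<and>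
     (SymD \<in> set X \<longrightarrow> game_deterministic AG G)"


section \<open>Actual neighborhood frames and abstract actual presentations\<close>

record ('st, 'ag) nbhd_frame =
  nb_states :: "'st set"
  nbhd :: "'ag set \<Rightarrow> 'st \<Rightarrow> 'st set set"

definition actual_nbhd_frame :: "'ag set \<Rightarrow> ('st, 'ag) nbhd_frame \<Rightarrow> bool" where
  "actual_nbhd_frame AG N \<longleftrightarrow>
     nb_states N \<noteq> {} \<and>
     (\<forall>C s. C \<subseteq> AG \<longrightarrow> s \<in> nb_states N \<longrightarrow> nbhd N C s \<subseteq> Pow (nb_states N))"

record ('i, 'st, 'ag) presentation =
  indices :: "'i set"
  out_at :: "'i \<Rightarrow> 'st set"
  indist :: "'ag \<Rightarrow> ('i \<times> 'i) set"

definition coal_indist :: "('i, 'st, 'ag) presentation \<Rightarrow> 'ag set \<Rightarrow> 'i \<Rightarrow> 'i \<Rightarrow> bool" where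
  "coal_indist P C i j \<longleftrightarrow>
     i \<in> indices P \<and> j \<in> indices P \<and> (\<forall>a \<in> C. (i, j) \<in> indist P a)"

definition coal_outcome :: "('i, 'st, 'ag) presentation \<Rightarrow> 'ag set \<Rightarrow> 'i \<Rightarrow> 'st set" where
  "coal_outcome P C i = \<Union> {out_at P j | j. j \<in> indices P \<and> coal_indist P C i j}"

definition presentation_at ::
    "'ag set \<Rightarrow> ('st, 'ag) nbhd_frame \<Rightarrow> 'st \<Rightarrow> ('i, 'st, 'ag) presentation \<Rightarrow> bool" where
  "presentation_at AG N s P \<longleftrightarrow>
     (\<forall>i \<in> indices P. out_at P i \<subseteq> nb_states N) \<and>
     (\<forall>a \<in> AG. equiv (indices P) (indist P a)) \<and>
     (\<forall>i \<in> indices P. \<forall>j \<in> indices P. coal_indist P AG i j \<longrightarrow> out_at P i = out_at P j) \<and>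
     (\<forall>C. C \<subseteq> AG \<longrightarrow> nbhd N C s = {coal_outcome P C i | i. i \<in> indices P})"

definition abstract_actual_presentation ::
    "'ag set \<Rightarrow> ('st, 'ag) nbhd_frame \<Rightarrow> ('st \<Rightarrow> ('i, 'st, 'ag) presentation) \<Rightarrow> bool" where
  "abstract_actual_presentation AG N \<I> \<longleftrightarrow> (\<forall>s \<in> nb_states N. presentation_at AG N s (\<I> s))"

definition amalgamating_at :: "'ag set \<Rightarrow> ('i, 'st, 'ag) presentation \<Rightarrow> bool" where
  "amalgamating_at AG P \<longleftrightarrow>
     (\<forall>i \<in> indices P. \<forall>j \<in> indices P. \<forall>C D. C \<subseteq> AG \<longrightarrow> D \<subseteq> AG \<longrightarrow> C \<inter> D = {} \<longrightarrow>
        (\<exists>k \<in> indices P. coal_indist P C i k \<and> coal_indist P D j k))"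

definition amalgamating ::
    "'ag set \<Rightarrow> ('st, 'ag) nbhd_frame \<Rightarrow> ('st \<Rightarrow> ('i, 'st, 'ag) presentation) \<Rightarrow> bool" where
  "amalgamating AG N \<I> \<longleftrightarrow> (\<forall>s \<in> nb_states N. amalgamating_at AG (\<I> s))"


subsection \<open>The universe of indices\<close>

text \<open>
  ``There is an abstract actual presentation'' quantifies over arbitrary index sets, whereas a
  formula can only quantify over subsets of a fixed type.  The type \<open>'st index\<close> loses no
  generality: by a downward Loewenheim-Skolem argument, a presentation over any index type can be
  replaced by one over \<open>'st index\<close>, and amalgamation is preserved
  (\<open>presentation_over_index\<close> below).
\<close>

type_synonym 'st index = "nat + 'st set"

lemma closure_small:
  includes cardinal_syntax
  fixes g :: "'i \<Rightarrow> 'i \<Rightarrow> 'p \<Rightarrow> 'i" and K :: "'k set"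
  assumes K: "infinite K" and B: "|B| \<le>o |K|" and T: "|T| \<le>o |K|"
    and BI: "B \<subseteq> I" and gI: "\<And>i j p. i \<in> I \<Longrightarrow> j \<in> I \<Longrightarrow> p \<in> T \<Longrightarrow> g i j p \<in> I"
  shows "\<exists>J. B \<subseteq> J \<and> J \<subseteq> I \<and> |J| \<le>o |K| \<and> (\<forall>i \<in> J. \<forall>j \<in> J. \<forall>p \<in> T. g i j p \<in> J)"
proof -
  define F where "F A = A \<union> (\<lambda>(i, j, p). g i j p) ` (A \<times> A \<times> T)" for A
  define L where "L n = (F ^^ n) B" for n :: nat
  have L0: "L 0 = B" and LS: "\<And>n. L (Suc n) = F (L n)"
    by (simp_all add: L_def)
  have mono: "L m \<subseteq> L n" if "m \<le> n" for m n
    using that by (rule lift_Suc_mono_le[rotated]) (auto simp: LS F_def)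
  have sub: "L n \<subseteq> I" for n
  proof (induction n)
    case 0
    show ?case using BI by (simp add: L0)
  next
    case (Suc n)
    then show ?case by (auto simp: LS F_def intro!: gI)
  qed
  have small: "|L n| \<le>o |K|" for n
  proof (induction n)
    case 0
    show ?case using B by (simp add: L0)
  next
    case (Suc n)
    have "|L n \<times> L n \<times> T| \<le>o |K|"
      by (intro card_of_Sigma_ordLeq_infinite K Suc T ballI)
    then have "|(\<lambda>(i, j, p). g i j p) ` (L n \<times> L n \<times> T)| \<le>o |K|"
      using card_of_image ordLeq_transitive by blast
    then show ?case
      unfolding LS F_def using K Suc
      by (intro card_of_Un_ordLeq_infinite_Field card_of_Card_order) (simp_all add: Field_card_of)
  qed
  show ?thesis
  proof (intro exI[of _ "\<Union>n. L n"] conjI ballI)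
    show "B \<subseteq> (\<Union>n. L n)" using L0 by blast
    show "(\<Union>n. L n) \<subseteq> I" using sub by blast
    have "|UNIV :: nat set| \<le>o |K|" using K infinite_iff_card_of_nat by blast
    then show "|\<Union>n. L n| \<le>o |K|"
      by (intro card_of_UNION_ordLeq_infinite K ballI small)
    show "g i j p \<in> (\<Union>n. L n)" if ij: "i \<in> (\<Union>n. L n)" "j \<in> (\<Union>n. L n)" "p \<in> T" for i j p
    proof -
      obtain m n where "i \<in> L m" "j \<in> L n" using ij by blast
      then have "i \<in> L (max m n)" "j \<in> L (max m n)"
        using mono[of m "max m n"] mono[of n "max m n"] by auto
      then have "g i j p \<in> L (Suc (max m n))"
        using ij(3) by (force simp: LS F_def)
      then show ?thesis by blast
    qed
  qed
qed

lemma mem_coal_outcome: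
  "t \<in> coal_outcome P C i \<longleftrightarrow> (\<exists>k. coal_indist P C i k \<and> t \<in> out_at P k)"
  by (auto simp: coal_outcome_def coal_indist_def)

lemma presentation_at_over_index:
  includes cardinal_syntax
  fixes P :: "('i, 'st, 'ag) presentation"
  assumes AG: "finite AG" and P: "presentation_at AG N s P"
  obtains Q :: "('st index, 'st, 'ag) presentation"
  where "presentation_at AG N s Q" "amalgamating_at AG P \<Longrightarrow> amalgamating_at AG Q"
proof -
  let ?I = "indices P"
  let ?K = "UNIV :: 'st index set"
  have K: "infinite ?K"
    by (simp add: finite_Plus_UNIV_iff)
  have sub: "\<And>i. i \<in> ?I \<Longrightarrow> out_at P i \<subseteq> nb_states N"
    and eq: "\<And>a. a \<in> AG \<Longrightarrow> equiv ?I (indist P a)"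
    and compat: "\<And>i j. i \<in> ?I \<Longrightarrow> j \<in> ?I \<Longrightarrow> coal_indist P AG i j \<Longrightarrow> out_at P i = out_at P j"
    and cover: "\<And>C. C \<subseteq> AG \<Longrightarrow> nbhd N C s = {coal_outcome P C i | i. i \<in> ?I}"
  proof -
    note P' = P[unfolded presentation_at_def]
    show "\<And>i. i \<in> ?I \<Longrightarrow> out_at P i \<subseteq> nb_states N"
      using P'[THEN conjunct1] by blast
    show "\<And>a. a \<in> AG \<Longrightarrow> equiv ?I (indist P a)"
      using P'[THEN conjunct2, THEN conjunct1] by blast
    show "\<And>i j. i \<in> ?I \<Longrightarrow> j \<in> ?I \<Longrightarrow> coal_indist P AG i j \<Longrightarrow> out_at P i = out_at P j"
      using P'[THEN conjunct2, THEN conjunct2, THEN conjunct1] by blast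
    show "\<And>C. C \<subseteq> AG \<Longrightarrow> nbhd N C s = {coal_outcome P C i | i. i \<in> ?I}"
      using P'[THEN conjunct2, THEN conjunct2, THEN conjunct2] by (elim allE impE)
  qed
  define pick where "pick = (\<lambda>(C, U). SOME i. i \<in> ?I \<and> coal_outcome P C i = U)"
  define B where "B = pick ` (SIGMA C : Pow AG. nbhd N C s)"
  have pick: "pick (C, U) \<in> ?I \<and> coal_outcome P C (pick (C, U)) = U"
    if CU: "C \<subseteq> AG" "U \<in> nbhd N C s" for C U
  proof -
    have "\<exists>i. i \<in> ?I \<and> coal_outcome P C i = U"
      using CU(2) unfolding cover[OF CU(1)] by blast
    from someI_ex[OF this] show ?thesis by (simp add: pick_def)
  qed
  define T :: "('ag set \<times> 'st + 'ag set \<times> 'ag set) set"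
    where "T = (Pow AG \<times> UNIV) <+> (Pow AG \<times> Pow AG)"
  define g where "g i j p = (case p of
      Inl (C, t) \<Rightarrow> (if \<exists>k. coal_indist P C i k \<and> t \<in> out_at P k
        then SOME k. coal_indist P C i k \<and> t \<in> out_at P k else i)
    | Inr (C, D) \<Rightarrow> (if \<exists>k. coal_indist P C i k \<and> coal_indist P D j k
        then SOME k. coal_indist P C i k \<and> coal_indist P D j k else i))"
    for i j and p :: "'ag set \<times> 'st + 'ag set \<times> 'ag set"
  have g1: "coal_indist P C i (g i j (Inl (C, t))) \<and> t \<in> out_at P (g i j (Inl (C, t)))"
    if "coal_indist P C i k" "t \<in> out_at P k" for C i j k t
  proof -
    have ex: "\<exists>k. coal_indist P C i k \<and> t \<in> out_at P k" using that by blast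
    show ?thesis using someI_ex[OF ex] ex by (simp add: g_def)
  qed
  have g2: "coal_indist P C i (g i j (Inr (C, D))) \<and> coal_indist P D j (g i j (Inr (C, D)))"
    if "coal_indist P C i k" "coal_indist P D j k" for C D i j k
  proof -
    have ex: "\<exists>k. coal_indist P C i k \<and> coal_indist P D j k" using that by blast
    show ?thesis using someI_ex[OF ex] ex by (simp add: g_def)
  qed
  have gI: "g i j p \<in> ?I" if "i \<in> ?I" "j \<in> ?I" for i j p
  proof (cases p)
    case (Inl q)
    obtain C t where q: "q = (C, t)" by fastforce
    show ?thesis
    proof (cases "\<exists>k. coal_indist P C i k \<and> t \<in> out_at P k")
      case True
      then show ?thesis using g1 Inl q by (metis coal_indist_def)
    next
      case False
      then show ?thesis using that Inl q by (auto simp: g_def)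
    qed
  next
    case (Inr q)
    obtain C D where q: "q = (C, D)" by fastforce
    show ?thesis
    proof (cases "\<exists>k. coal_indist P C i k \<and> coal_indist P D j k")
      case True
      then show ?thesis using g2 Inr q by (metis coal_indist_def)
    next
      case False
      then show ?thesis using that Inr q by (auto simp: g_def)
    qed
  qed
  have fin: "|A| \<le>o |?K|" if "finite A" for A :: "'x set"
    using ordLeq_total[OF card_of_Well_order card_of_Well_order, of A ?K]
      card_of_ordLeq_finite[of ?K A] K that by blast
  have setK: "|A| \<le>o |?K|" for A :: "'st set set"
    by (rule card_of_ordLeqI[of Inr]) auto
  have B: "|B| \<le>o |?K|"
  proof -
    have "|SIGMA C : Pow AG. nbhd N C s| \<le>o |?K|"
      by (intro card_of_Sigma_ordLeq_infinite K ballI setK fin) (simp add: AG)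
    then show ?thesis
      unfolding B_def using card_of_image ordLeq_transitive by blast
  qed
  have T: "|T| \<le>o |?K|"
  proof -
    have st: "|UNIV :: 'st set| \<le>o |?K|"
      by (rule card_of_ordLeqI[of "\<lambda>x. Inr {x}"]) (auto intro: injI)
    have "|Pow AG \<times> (UNIV :: 'st set)| \<le>o |?K|"
      by (intro card_of_Sigma_ordLeq_infinite K ballI st fin) (simp add: AG)
    moreover have "|Pow AG \<times> Pow AG| \<le>o |?K|"
      by (intro fin) (simp add: AG)
    ultimately show ?thesis
      unfolding T_def using K
      by (intro card_of_Plus_ordLeq_infinite_Field card_of_Card_order) (simp_all add: Field_card_of)
  qed
  have BI: "B \<subseteq> ?I" using pick by (auto simp: B_def)
  have ex: "\<exists>J. B \<subseteq> J \<and> J \<subseteq> ?I \<and> |J| \<le>o |?K| \<and> (\<forall>i \<in> J. \<forall>j \<in> J. \<forall>p \<in> T. g i j p \<in> J)"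
    by (rule closure_small[OF K B T BI gI])
  obtain J where BJ: "B \<subseteq> J" and JI: "J \<subseteq> ?I" and J: "|J| \<le>o |?K|"
    and gJ: "\<And>i j p. i \<in> J \<Longrightarrow> j \<in> J \<Longrightarrow> p \<in> T \<Longrightarrow> g i j p \<in> J"
    using ex by (elim exE conjE) simp
  obtain f :: "'i \<Rightarrow> 'st index" where f: "inj_on f J"
    using J card_of_ordLeq[of J ?K] by blast
  define h where "h = the_inv_into J f"
  have hf: "h (f i) = i" if "i \<in> J" for i
    using f that by (simp add: h_def the_inv_into_f_f)
  define Q where "Q = \<lparr>indices = f ` J, out_at = (\<lambda>i. out_at P (h i)),
     indist = (\<lambda>a. {(f i, f j) | i j. i \<in> J \<and> j \<in> J \<and> (i, j) \<in> indist P a})\<rparr>"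
  have QI: "indices Q = f ` J" and QO: "\<And>i. i \<in> J \<Longrightarrow> out_at Q (f i) = out_at P i"
    by (simp_all add: Q_def hf)
  have QE: "(f i, f j) \<in> indist Q a \<longleftrightarrow> (i, j) \<in> indist P a" if "i \<in> J" "j \<in> J" for i j a
    using that f by (auto simp: Q_def dest: inj_onD)
  have QC: "coal_indist Q C (f i) (f j) \<longleftrightarrow> coal_indist P C i j" if "i \<in> J" "j \<in> J" for i j C
    using that JI by (auto simp: coal_indist_def QI QE)
  have Qrho: "coal_outcome Q C (f i) = coal_outcome P C i" if i: "i \<in> J" and C: "C \<subseteq> AG" for i C
  proof
    show "coal_outcome Q C (f i) \<subseteq> coal_outcome P C i"
    proof
      fix t assume "t \<in> coal_outcome Q C (f i)"
      then obtain y where y: "coal_indist Q C (f i) y" "t \<in> out_at Q y"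
        unfolding mem_coal_outcome by blast
      then obtain k where "y = f k" "k \<in> J"
        unfolding coal_indist_def QI by blast
      then have "coal_indist P C i k" "t \<in> out_at P k"
        using y i by (simp_all add: QC QO)
      then show "t \<in> coal_outcome P C i"
        unfolding mem_coal_outcome by blast
    qed
    show "coal_outcome P C i \<subseteq> coal_outcome Q C (f i)"
    proof
      fix t assume "t \<in> coal_outcome P C i"
      then obtain k where k: "coal_indist P C i k" "t \<in> out_at P k"
        unfolding mem_coal_outcome by blast
      let ?k = "g i i (Inl (C, t))"
      have kJ: "?k \<in> J" using i C by (intro gJ) (simp_all add: T_def InlI)
      have "coal_indist P C i ?k" "t \<in> out_at P ?k" using g1[OF k] by auto
      then have "coal_indist Q C (f i) (f ?k)" "t \<in> out_at Q (f ?k)"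
        using i kJ by (simp_all add: QC QO)
      then show "t \<in> coal_outcome Q C (f i)"
        unfolding mem_coal_outcome by blast
    qed
  qed
  have "presentation_at AG N s Q"
    unfolding presentation_at_def
  proof (intro conjI ballI allI impI)
    show "out_at Q i \<subseteq> nb_states N" if i: "i \<in> indices Q" for i
    proof -
      obtain k where "i = f k" "k \<in> J" using i unfolding QI by blast
      then show ?thesis using sub[of k] JI by (auto simp: QO)
    qed
    show "equiv (indices Q) (indist Q a)" if a: "a \<in> AG" for a
    proof (rule equivI)
      have r: "refl_on ?I (indist P a)" and sy: "sym (indist P a)" and tr: "trans (indist P a)"
        using eq[OF a] by (auto elim: equivE)
      have E: "\<exists>i j. x = f i \<and> y = f j \<and> i \<in> J \<and> j \<in> J \<and> (i, j) \<in> indist P a"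
        if "(x, y) \<in> indist Q a" for x y
        using that by (simp add: Q_def)
      show "indist Q a \<subseteq> indices Q \<times> indices Q"
        unfolding QI using E by fast
      show "refl_on (indices Q) (indist Q a)"
      proof (rule refl_onI)
        fix x assume "x \<in> indices Q"
        then obtain i where i: "x = f i" "i \<in> J" unfolding QI by blast
        then have "(i, i) \<in> indist P a" using r JI by (blast dest: refl_onD)
        then show "(x, x) \<in> indist Q a" using i by (simp add: QE)
      qed
      show "sym (indist Q a)"
      proof (rule symI)
        fix x y assume "(x, y) \<in> indist Q a"
        then obtain i j where ij: "x = f i" "y = f j" "i \<in> J" "j \<in> J" "(i, j) \<in> indist P a"
          using E by blast
        then show "(y, x) \<in> indist Q a" using symD[OF sy ij(5)] by (simp add: QE)
      qed
      show "trans (indist Q a)"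
      proof (rule transI)
        fix x y z assume xy: "(x, y) \<in> indist Q a" and yz: "(y, z) \<in> indist Q a"
        obtain i j where ij: "x = f i" "y = f j" "i \<in> J" "j \<in> J" "(i, j) \<in> indist P a"
          using E[OF xy] by blast
        obtain j' k where jk: "y = f j'" "z = f k" "j' \<in> J" "k \<in> J" "(j', k) \<in> indist P a"
          using E[OF yz] by blast
        have "j' = j" using f ij jk by (metis inj_onD)
        then have "(i, k) \<in> indist P a" using transD[OF tr ij(5)] jk(5) by simp
        then show "(x, z) \<in> indist Q a" using ij jk by (simp add: QE)
      qed
    qed
    show "out_at Q i = out_at Q j"
      if ij: "i \<in> indices Q" "j \<in> indices Q" "coal_indist Q AG i j" for i j
    proof -
      obtain k l where "i = f k" "j = f l" "k \<in> J" "l \<in> J"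
        using ij(1,2) unfolding QI by blast
      then show ?thesis
        using compat[of k l] ij(3) JI by (auto simp: QO QC)
    qed
    show "nbhd N C s = {coal_outcome Q C i | i. i \<in> indices Q}" if C: "C \<subseteq> AG" for C
    proof
      show "nbhd N C s \<subseteq> {coal_outcome Q C i | i. i \<in> indices Q}"
      proof
        fix U assume U: "U \<in> nbhd N C s"
        have "(C, U) \<in> (SIGMA C : Pow AG. nbhd N C s)" using U C by simp
        then have J: "pick (C, U) \<in> J" using BJ unfolding B_def by blast
        have "U = coal_outcome Q C (f (pick (C, U)))"
          using pick[OF C U] Qrho[OF J C] by simp
        then show "U \<in> {coal_outcome Q C i | i. i \<in> indices Q}"
          using J unfolding QI by blast
      qed
      show "{coal_outcome Q C i | i. i \<in> indices Q} \<subseteq> nbhd N C s"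
      proof
        fix U assume "U \<in> {coal_outcome Q C i | i. i \<in> indices Q}"
        then obtain i where "U = coal_outcome Q C (f i)" "i \<in> J"
          unfolding QI by blast
        then show "U \<in> nbhd N C s"
          unfolding cover[OF C] using Qrho[OF _ C] JI by blast
      qed
    qed
  qed
  moreover have "amalgamating_at AG Q" if am: "amalgamating_at AG P"
    unfolding amalgamating_at_def QI
  proof (intro ballI allI impI)
    fix x y C D
    assume "x \<in> f ` J" "y \<in> f ` J" and CD: "C \<subseteq> AG" "D \<subseteq> AG" "C \<inter> D = {}"
    then obtain i j where ij: "x = f i" "y = f j" "i \<in> J" "j \<in> J" by blast
    have "i \<in> ?I" "j \<in> ?I" using ij JI by auto
    from am[unfolded amalgamating_at_def, rule_format, OF this CD]
    obtain k where k: "coal_indist P C i k" "coal_indist P D j k"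
      by (elim bexE conjE)
    let ?k = "g i j (Inr (C, D))"
    have "?k \<in> J" using ij CD by (intro gJ) (simp_all add: T_def InrI)
    then show "\<exists>k \<in> f ` J. coal_indist Q C x k \<and> coal_indist Q D y k"
      using g2[OF k] ij by (intro bexI[of _ "f ?k"]) (simp_all add: QC)
  qed
  ultimately show thesis by (rule that)
qed

theorem presentation_over_index:
  fixes \<I> :: "'st \<Rightarrow> ('i, 'st, 'ag) presentation"
  assumes AG: "finite AG" and P: "abstract_actual_presentation AG N \<I>"
  obtains \<J> :: "'st \<Rightarrow> ('st index, 'st, 'ag) presentation"
  where "abstract_actual_presentation AG N \<J>" "amalgamating AG N \<I> \<Longrightarrow> amalgamating AG N \<J>"
proof -
  have "\<forall>s. \<exists>Q :: ('st index, 'st, 'ag) presentation. s \<in> nb_states N \<longrightarrow>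
      presentation_at AG N s Q \<and> (amalgamating_at AG (\<I> s) \<longrightarrow> amalgamating_at AG Q)"
    using P presentation_at_over_index[OF AG]
    unfolding abstract_actual_presentation_def by metis
  then obtain \<J> :: "'st \<Rightarrow> ('st index, 'st, 'ag) presentation"
    where "\<forall>s. s \<in> nb_states N \<longrightarrow>
      presentation_at AG N s (\<J> s) \<and> (amalgamating_at AG (\<I> s) \<longrightarrow> amalgamating_at AG (\<J> s))"
    by metis
  then show thesis
    by (intro that[of \<J>]) (auto simp: abstract_actual_presentation_def amalgamating_def)
qed


section \<open>AC-abstract-representative frames\<close>

definition AC_abstract_representative :: "'ag set \<Rightarrow> ('st, 'ag) nbhd_frame \<Rightarrow> bool" where
  "AC_abstract_representative AG N \<longleftrightarrow>
     actual_nbhd_frame AG N \<and>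
     (\<exists>\<I> :: 'st \<Rightarrow> ('st index, 'st, 'ag) presentation. abstract_actual_presentation AG N \<I>) \<and>
     (\<forall>C s. C \<subseteq> AG \<longrightarrow> s \<in> nb_states N \<longrightarrow> {} \<notin> nbhd N C s)"

definition AC_abstract_serial :: "'ag set \<Rightarrow> ('st, 'ag) nbhd_frame \<Rightarrow> bool" where
  "AC_abstract_serial AG N \<longleftrightarrow> (\<forall>C s. C \<subseteq> AG \<longrightarrow> s \<in> nb_states N \<longrightarrow> nbhd N C s \<noteq> {})"

definition AC_abstract_independent :: "'ag set \<Rightarrow> ('st, 'ag) nbhd_frame \<Rightarrow> bool" where
  "AC_abstract_independent AG N \<longleftrightarrow>
     (\<exists>\<I> :: 'st \<Rightarrow> ('st index, 'st, 'ag) presentation.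
        abstract_actual_presentation AG N \<I> \<and> amalgamating AG N \<I>)"

definition AC_abstract_deterministic :: "'ag set \<Rightarrow> ('st, 'ag) nbhd_frame \<Rightarrow> bool" where
  "AC_abstract_deterministic AG N \<longleftrightarrow>
     (\<forall>s \<in> nb_states N. \<forall>U \<in> nbhd N AG s. is_singleton U)"

definition AC_abstract_representative_X_frame ::
    "frame_symbol list \<Rightarrow> 'ag set \<Rightarrow> ('st, 'ag) nbhd_frame \<Rightarrow> bool" where
  "AC_abstract_representative_X_frame X AG N \<longleftrightarrow>
     AC_abstract_representative AG N \<and>
     (SymS \<in> set X \<longrightarrow> AC_abstract_serial AG N) \<and>
     (SymI \<in> set X \<longrightarrow> AC_abstract_independent AG N) \<and>
     (SymD \<in> set X \<longrightarrow> AC_abstract_deterministic AG N)"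

end

theory Submission
  imports Defs
begin

text \<open>
  At a state, take the available grand-coalition actions as indices, two of them being
  indistinguishable for \<open>a\<close> when they prescribe the same action to \<open>a\<close>.  By (GCI), restriction
  maps the available actions of \<open>AG\<close> onto those of \<open>C\<close>, and the outcome of \<open>C\<close> at a restriction
  is the union of the outcomes over the \<open>C\<close>-class.  Under independence, two indices are
  amalgamated by joining their restrictions to \<open>C\<close> and \<open>D\<close> and extending the result to an
  available action of \<open>AG\<close>.
\<close>

definition action_presentation ::
    "'ag set \<Rightarrow> ('st, 'act, 'ag) action_frame \<Rightarrow> 'st \<Rightarrow> ('ag \<rightharpoonup> 'act, 'st, 'ag) presentation" where
  "action_presentation AG G s =
     \<lparr>indices = avail G AG s, out_at = outcome G AG s,
      indist = (\<lambda>a. {(\<sigma>, \<tau>). \<sigma> \<in> avail G AG s \<and> \<tau> \<in> avail G AG s \<and> \<sigma> a = \<tau> a})\<rparr>"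

lemma restrict_map_eq_iff: "f |` C = g |` C \<longleftrightarrow> (\<forall>a \<in> C. f a = g a)"
  by (auto simp: fun_eq_iff restrict_map_def)

lemma joint_actions_restrict:
  assumes "\<sigma> \<in> joint_actions AC AG" "C \<subseteq> AG"
  shows "\<sigma> |` C \<in> joint_actions AC C"
  using assms by (fastforce simp: joint_actions_def ran_def restrict_map_def dom_def split: if_splits)

lemma indices_action_presentation [simp]:
    "indices (action_presentation AG G s) = avail G AG s"
  and out_at_action_presentation [simp]:
    "out_at (action_presentation AG G s) = outcome G AG s"
  and indist_action_presentation [simp]:
    "indist (action_presentation AG G s) a =
      {(\<sigma>, \<tau>). \<sigma> \<in> avail G AG s \<and> \<tau> \<in> avail G AG s \<and> \<sigma> a = \<tau> a}"
  by (simp_all add: action_presentation_def)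

text \<open>Turns agentwise agreement into equality of restrictions, the form in which (GCI) speaks;
  for \<open>C = {}\<close> both restrictions are empty and the relation is universal on the
  indices.\<close>

lemma coal_indist_action_presentation:
  "coal_indist (action_presentation AG G s) C \<sigma> \<tau> \<longleftrightarrow>
     \<sigma> \<in> avail G AG s \<and> \<tau> \<in> avail G AG s \<and> \<sigma> |` C = \<tau> |` C"
  by (auto simp: coal_indist_def restrict_map_eq_iff)

context
  fixes AG :: "'ag set" and G :: "('st, 'act, 'ag) action_frame" and s
  assumes G: "general_concurrent_game_frame AG G" and s: "s \<in> states G"
begin

lemma outcome_eq:
  assumes "C \<subseteq> AG" "\<sigma>C \<in> joint_actions (actions G) C"
  shows "outcome G C s \<sigma>C =
    \<Union> {outcome G AG s \<sigma> | \<sigma>. \<sigma> \<in> joint_actions (actions G) AG \<and> \<sigma> |` C = \<sigma>C}"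
  using conjunct2[OF G[unfolded general_concurrent_game_frame_def], rule_format, OF assms(1) s]
    assms(2) by (elim conjE) (drule bspec)

lemma avail_iff:
  assumes "C \<subseteq> AG"
  shows "\<sigma> \<in> avail G C s \<longleftrightarrow> \<sigma> \<in> joint_actions (actions G) C \<and> outcome G C s \<sigma> \<noteq> {}"
  using conjunct2[OF G[unfolded general_concurrent_game_frame_def], rule_format, OF assms s]
  by simp

lemma outcome_subset_states:
  assumes "C \<subseteq> AG" "\<sigma> \<in> joint_actions (actions G) C"
  shows "outcome G C s \<sigma> \<subseteq> states G"
proof -
  have "is_action_frame AG G"
    using G unfolding general_concurrent_game_frame_def by (rule conjunct1)
  then show ?thesis
    using s assms by (simp add: is_action_frame_def)
qed

text \<open>(GCI) with its union cut down to available actions: by (ODA), a joint action of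
  \<open>AG\<close> that has an outcome is available, so the others contribute nothing.\<close>

lemma mem_outcome_iff:
  assumes "C \<subseteq> AG" "\<sigma>C \<in> joint_actions (actions G) C"
  shows "t \<in> outcome G C s \<sigma>C \<longleftrightarrow>
    (\<exists>\<sigma> \<in> avail G AG s. \<sigma> |` C = \<sigma>C \<and> t \<in> outcome G AG s \<sigma>)"
proof -
  have "\<sigma> \<in> joint_actions (actions G) AG \<and> t \<in> outcome G AG s \<sigma> \<longleftrightarrow>
      \<sigma> \<in> avail G AG s \<and> t \<in> outcome G AG s \<sigma>" for \<sigma>
    by (auto simp: avail_iff)
  then show ?thesis
    unfolding outcome_eq[OF assms] Bex_def by (simp add: Setcompr_eq_image Bex_def) metis
qed

text \<open>By (ODA) the given action has some outcome, and (GCI) attributes that outcome to an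
  available action of \<open>AG\<close> extending it.\<close>

lemma avail_extend:
  assumes "C \<subseteq> AG" "\<sigma>C \<in> avail G C s"
  obtains \<sigma> where "\<sigma> \<in> avail G AG s" "\<sigma> |` C = \<sigma>C"
proof -
  have \<sigma>C: "\<sigma>C \<in> joint_actions (actions G) C" and "outcome G C s \<sigma>C \<noteq> {}"
    using assms by (simp_all add: avail_iff)
  then obtain t where "t \<in> outcome G C s \<sigma>C" by blast
  then show thesis
    unfolding mem_outcome_iff[OF assms(1) \<sigma>C] by (elim bexE conjE) (rule that)
qed

lemma restrict_avail_joint_actions:
  assumes "C \<subseteq> AG" "\<sigma> \<in> avail G AG s"
  shows "\<sigma> |` C \<in> joint_actions (actions G) C"
  using assms by (intro joint_actions_restrict[OF _ assms(1)]) (simp add: avail_iff)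

text \<open>Any outcome of \<open>\<sigma>\<close> is by (GCI) also an outcome of its restriction,
  which is then available by (ODA).\<close>

lemma avail_restrict:
  assumes "C \<subseteq> AG" "\<sigma> \<in> avail G AG s"
  shows "\<sigma> |` C \<in> avail G C s"
proof -
  note r = restrict_avail_joint_actions[OF assms]
  obtain t where "t \<in> outcome G AG s \<sigma>"
    using assms(2) by (auto simp: avail_iff)
  then have "t \<in> outcome G C s (\<sigma> |` C)"
    unfolding mem_outcome_iff[OF assms(1) r] using assms(2) by (intro bexI[of _ \<sigma>] conjI refl)
  then show ?thesis
    unfolding avail_iff[OF assms(1)] using r by (intro conjI) auto
qed

text \<open>Both sides collect the outcomes of the available actions that agree with
  \<open>\<sigma>\<close> on \<open>C\<close>.\<close>

lemma coal_outcome_action_presentation: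
  assumes "C \<subseteq> AG" "\<sigma> \<in> avail G AG s"
  shows "coal_outcome (action_presentation AG G s) C \<sigma> = outcome G C s (\<sigma> |` C)"
proof (rule set_eqI)
  fix t
  show "t \<in> coal_outcome (action_presentation AG G s) C \<sigma> \<longleftrightarrow> t \<in> outcome G C s (\<sigma> |` C)"
    unfolding mem_coal_outcome coal_indist_action_presentation out_at_action_presentation
      mem_outcome_iff[OF assms(1) restrict_avail_joint_actions[OF assms]]
    using assms(2) by (simp add: Bex_def eq_commute[of "\<sigma> |` C"] conj_assoc)
qed

lemma presentation_at_action_presentation:
  assumes N: "nb_states N = states G"
    and nb: "\<And>C. C \<subseteq> AG \<Longrightarrow> nbhd N C s = {outcome G C s \<sigma>C | \<sigma>C. \<sigma>C \<in> avail G C s}"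
  shows "presentation_at AG N s (action_presentation AG G s)" (is "presentation_at _ _ _ ?P")
  unfolding presentation_at_def
proof (intro conjI ballI allI impI)
  show "out_at ?P i \<subseteq> nb_states N" if "i \<in> indices ?P" for i
    using that outcome_subset_states[OF subset_refl] by (simp add: N avail_iff)
  show "equiv (indices ?P) (indist ?P a)" for a
    by (rule equivI) (auto simp: refl_on_def sym_def trans_def)
  show "out_at ?P i = out_at ?P j" if "coal_indist ?P AG i j" for i j
  proof -
    have "i |` AG = j |` AG" "dom i = AG" "dom j = AG"
      using that by (simp_all add: coal_indist_action_presentation avail_iff joint_actions_def)
    \<comment> \<open>Both maps have domain exactly \<open>AG\<close>, so agreement on
      \<open>AG\<close> is equality and grand compatibility becomes trivial.\<close>
    then have "i = j" by (intro map_le_antisym) (simp_all add: map_le_def restrict_map_eq_iff)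
    then show ?thesis by simp
  qed
  show "nbhd N C s = {coal_outcome ?P C i | i. i \<in> indices ?P}" if C: "C \<subseteq> AG" for C
  proof -
    \<comment> \<open>Coverage reduces to this: restriction maps the indices onto the available
      actions of \<open>C\<close>.\<close>
    have av: "avail G C s = (\<lambda>\<sigma>. \<sigma> |` C) ` avail G AG s"
    proof (intro equalityI subsetI)
      fix \<sigma>C assume "\<sigma>C \<in> avail G C s"
      then obtain \<sigma> where "\<sigma> \<in> avail G AG s" "\<sigma> |` C = \<sigma>C" by (rule avail_extend[OF C])
      then show "\<sigma>C \<in> (\<lambda>\<sigma>. \<sigma> |` C) ` avail G AG s" by blast
    qed (auto intro: avail_restrict[OF C])
    show ?thesis
      unfolding nb[OF C] Setcompr_eq_image Collect_mem_eq av image_image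
      by (simp add: coal_outcome_action_presentation[OF C])
  qed
qed

lemma amalgamating_at_action_presentation:
  assumes "game_independent AG G"
  shows "amalgamating_at AG (action_presentation AG G s)" (is "amalgamating_at _ ?P")
  unfolding amalgamating_at_def
proof (intro ballI allI impI)
  fix i j C D
  assume "i \<in> indices ?P" "j \<in> indices ?P" and CD: "C \<subseteq> AG" "D \<subseteq> AG" "C \<inter> D = {}"
  then have ij: "i \<in> avail G AG s" "j \<in> avail G AG s"
    by simp_all
  have CD': "C \<union> D \<subseteq> AG" using CD by simp
  have "i |` C ++ j |` D \<in> avail G (C \<union> D) s"
    using assms s CD avail_restrict[OF CD(1) ij(1)] avail_restrict[OF CD(2) ij(2)]
    by (simp add: game_independent_def)
  then obtain k where k: "k \<in> avail G AG s" "k |` (C \<union> D) = i |` C ++ j |` D"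
    by (rule avail_extend[OF CD'])
  have dom: "dom j = AG"
    using ij(2) by (simp add: avail_iff joint_actions_def)
  have k_eq: "k a = (i |` C ++ j |` D) a" if "a \<in> C \<union> D" for a
    using fun_cong[OF k(2), of a] that by simp
  have "k a = i a" if "a \<in> C" for a
  proof -
    \<comment> \<open>The right operand of \<open>++\<close> takes precedence, so disjointness is
      what makes the value at \<open>a\<close> come from \<open>i\<close>.\<close>
    have "a \<notin> D" using CD(3) that by blast
    then show ?thesis using k_eq[of a] that by (simp add: map_add_def)
  qed
  moreover have "k a = j a" if "a \<in> D" for a
  proof -
    \<comment> \<open>\<open>++\<close> falls back to its left operand where the right one is
      undefined; totality of \<open>j\<close> on \<open>AG\<close> excludes this.\<close>
    have "j a \<noteq> None" using dom CD(2) that by blast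
    then show ?thesis using k_eq[of a] that by (auto simp: map_add_def)
  qed
  ultimately show "\<exists>k \<in> indices ?P. coal_indist ?P C i k \<and> coal_indist ?P D j k"
    using ij k(1)
    by (intro bexI[of _ k])
      (simp_all add: coal_indist_action_presentation restrict_map_eq_iff)
qed

end

theorem theorem5:
  fixes AG :: "'ag set"
    and X :: "frame_symbol list"
    and G :: "('st, 'act, 'ag) action_frame"
    and N :: "('st, 'ag) nbhd_frame"
  assumes "finite AG" and "AG \<noteq> {}"
    and "X \<in> {[], [SymS], [SymI], [SymD], [SymS, SymI], [SymS, SymD], [SymI, SymD],
              [SymS, SymI, SymD]}"
    and "game_X_frame X AG G"
    and "nb_states N = states G"
    and "\<And>s C. s \<in> states G \<Longrightarrow> C \<subseteq> AG \<Longrightarrow>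
           nbhd N C s = {outcome G C s \<sigma>C | \<sigma>C. \<sigma>C \<in> avail G C s}"
  shows "AC_abstract_representative_X_frame X AG N"
proof -
  note N = assms(5) and nb = assms(6)
  have G: "general_concurrent_game_frame AG G"
    and S: "SymS \<in> set X \<Longrightarrow> game_serial AG G"
    and I: "SymI \<in> set X \<Longrightarrow> game_independent AG G"
    and D: "SymD \<in> set X \<Longrightarrow> game_deterministic AG G"
    using assms(4) by (auto simp: game_X_frame_def)
  have "abstract_actual_presentation AG N (action_presentation AG G)"
    unfolding abstract_actual_presentation_def
    by (simp add: N nb presentation_at_action_presentation[OF G])
  \<comment> \<open>The indices so far are partial maps into \<open>'act\<close>, while the
    definitions require the type \<open>'st index\<close>; finiteness of \<open>AG\<close> permits
    the transfer, and amalgamation survives it.\<close>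
  from presentation_over_index[OF assms(1) this]
  obtain \<J> :: "'st \<Rightarrow> ('st index, 'st, 'ag) presentation"
    where J: "abstract_actual_presentation AG N \<J>"
      and am: "amalgamating AG N (action_presentation AG G) \<Longrightarrow> amalgamating AG N \<J>"
    by blast
  have "states G \<noteq> {}"
    using G by (simp add: general_concurrent_game_frame_def is_action_frame_def)
  moreover have "nbhd N C s \<subseteq> Pow (states G)" if C: "C \<subseteq> AG" and s: "s \<in> states G" for C s
  proof
    fix U assume "U \<in> nbhd N C s"
    then obtain \<sigma> where "U = outcome G C s \<sigma>" "\<sigma> \<in> avail G C s"
      unfolding nb[OF s C] by blast
    then show "U \<in> Pow (states G)"
      using avail_iff[OF G s C] outcome_subset_states[OF G s C] by simp
  qed
  ultimately have "actual_nbhd_frame AG N"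
    unfolding actual_nbhd_frame_def N by blast
  \<comment> \<open>Liveness is (ODA): available actions have nonempty outcomes.\<close>
  moreover have "{} \<notin> nbhd N C s" if "C \<subseteq> AG" "s \<in> states G" for C s
    using nb[OF that(2,1)] avail_iff[OF G that(2,1)] by auto
  ultimately have "AC_abstract_representative AG N"
    using J unfolding AC_abstract_representative_def N by blast
  moreover have "AC_abstract_serial AG N" if "SymS \<in> set X"
    unfolding AC_abstract_serial_def N
  proof (intro allI impI)
    fix C s assume Cs: "C \<subseteq> AG" "s \<in> states G"
    then have "avail G C s \<noteq> {}"
      using S[OF \<open>SymS \<in> set X\<close>] unfolding game_serial_def by blast
    then show "nbhd N C s \<noteq> {}"
      unfolding nb[OF Cs(2,1)] by blast
  qed
  moreover have "AC_abstract_independent AG N" if "SymI \<in> set X"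
  proof -
    have "amalgamating AG N (action_presentation AG G)"
      using amalgamating_at_action_presentation[OF G] I[OF that]
      unfolding amalgamating_def N by blast
    then show ?thesis
      using J am unfolding AC_abstract_independent_def by blast
  qed
  moreover have "AC_abstract_deterministic AG N" if "SymD \<in> set X"
    using D[OF that] nb[OF _ subset_refl]
    unfolding AC_abstract_deterministic_def game_deterministic_def N by auto
  ultimately show ?thesis
    unfolding AC_abstract_representative_X_frame_def by blast
qed

end
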